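(* There is an absolute constant $C>0$ such that for all odd positive integers $n$, $$\Phi_2(n)\,\le\, C\,(\log\log\log\omega(n))\,(\log\omega(n))\,w(n).$$
   Context: For a positive integer $n$, $\Phi_2(n)=\sum_{d\mid n}\frac{(\log d)\log\Omega(d)}{d}$, the sum being over positive divisors $d$ of $n$, where $\Omega(d)$ is the total number of prime factors of $d$ counted with multiplicity (with the convention $0\log 0=0$, so that the term $d=1$ is $0$). $\omega(n)$ is the number of prime divisors of $n$ counted without multiplicity, and $w(n)=\sum_{p\mid n}\frac{\log p}{p}$ (sum over the primes $p$ dividing $n$) is Davenport's function. Convention: $\log\log\log x$ equals $1$ if $0\le x\le e^{e^{e}}$, and equals $\log\log\log x$ in the usual sense if $x>e^{e^{e}}$.
   Formalization: The factor log ω(n) is read as 1 when ω(n) ≤ 1, since with the usual logarithm the bound fails for odd prime powers p^k with k ≥ 2 (e.g. n = 9, where the right side is 0 but Φ_2(9) > 0). *)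

theory Defs
  imports Complex_Main "HOL-Computational_Algebra.Primes"
begin

definition Omega_total :: "nat \<Rightarrow> nat" where
  "Omega_total n = size (prime_factorization n)"

definition omega_distinct :: "nat \<Rightarrow> nat" where
  "omega_distinct n = card (prime_factors n)"

text \<open>
  The term for \<open>d = 1\<close> is \<open>ln 1 * ln 0 / 1 = 0\<close>, as the convention \<open>0 log 0 = 0\<close> demands.
\<close>
definition Phi2 :: "nat \<Rightarrow> real" where
  "Phi2 n = (\<Sum>d | d dvd n. ln (real d) * ln (real (Omega_total d)) / real d)"

definition davenport_w :: "nat \<Rightarrow> real" where
  "davenport_w n = (\<Sum>p | prime p \<and> p dvd n. ln (real p) / real p)"

definition logloglog :: "real \<Rightarrow> real" where
  "logloglog x = (if x \<le> exp (exp (exp 1)) then 1 else ln (ln (ln x)))"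

text \<open>
  The factor \<open>log \<omega>(n)\<close> vanishes when \<open>\<omega>(n) = 1\<close>, whereas \<open>Phi2 (p ^ k) > 0\<close> for \<open>p\<close> prime and
  \<open>k \<ge> 2\<close> (for example \<open>Phi2 9 = 2 * ln 3 * ln 2 / 9\<close>). With the usual logarithm the bound
  therefore fails at the proper prime powers, and the degenerate value of the logarithm is
  replaced by \<open>1\<close>, in the same way as for \<open>logloglog\<close>. On integers \<open>x \<ge> 2\<close> this is the
  usual logarithm. For \<open>\<omega>(n) = 0\<close>, i.e. \<open>n = 1\<close>, the value is irrelevant since \<open>davenport_w 1 = 0\<close>.
\<close>
definition log1 :: "real \<Rightarrow> real" where
  "log1 x = (if x \<le> 1 then 1 else ln x)"

end

theory Submission
  imports Defs
begin

text \<open>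
  Weight every divisor \<open>d\<close> of \<open>n\<close> by \<open>1 / d\<close>. The total weight is \<open>\<sigma>(n) / n\<close>, and since the weight is
  multiplicative, the exponents of the different primes in \<open>d\<close> are independent random variables.
  The exponent of \<open>p\<close> and its square have means of order \<open>1 / p\<close>. Write \<open>w\<close> for Davenport's sum and
  \<open>r = \<Sum> 1 / p\<close>, over the primes dividing \<open>n\<close>. Then \<open>ln d\<close> has mean \<open>O(w)\<close>, \<open>\<Omega>(d)\<close> has mean \<open>O(r)\<close>,
  and their product has mean \<open>O(w (1 + r))\<close>
  (\<open>dsum_ln_le\<close>, \<open>dsum_Om_le\<close>, \<open>dsum_ln_Om_le\<close>).

  The logarithm of \<open>\<Omega>(d)\<close> is handled by its tangent at \<open>T = 1 + r\<close>: \<open>ln \<Omega> \<le> ln T + \<Omega> / T\<close>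
  (\<open>Phi2_le_linearised\<close>). With this choice of \<open>T\<close> the mean of \<open>ln d * \<Omega>(d) / T\<close> is only \<open>O(w)\<close>, so
  \<open>Phi2 n\<close> is at most a constant times \<open>(\<sigma>(n) / n) * w * (1 + ln T)\<close>.

  It remains to express the two factors by \<open>k = \<omega>(n)\<close>. Mertens' upper bound for the sum of the
  reciprocals of the primes (\<open>mertens_second_upper\<close>) gives \<open>r \<le> ln ln k + O(1)\<close>
  (\<open>prime_sum_one_le\<close>). Hence, with the conventions made for small \<open>k\<close>, \<open>ln T = O(ln ln ln k)\<close> and \<open>\<sigma>(n) / n \<le> exp (r + 1) = O(ln k)\<close>.
  The coefficient 1 of \<open>ln ln k\<close> matters, as it becomes the exponent of \<open>ln k\<close>.
\<close>

section \<open>Sums over divisors weighted by reciprocals\<close>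

text \<open>
  Splitting off the full power of a prime at each step keeps the two factors coprime, which is
  what the divisor sums need in order to factor.
\<close>

lemma coprime_prime_power_induct [consumes 1, case_names one prime_power]:
  fixes P :: "nat \<Rightarrow> bool"
  assumes "0 < n"
    and one: "P 1"
    and step: "\<And>p a m. prime p \<Longrightarrow> 0 < a \<Longrightarrow> 0 < m \<Longrightarrow> \<not> p dvd m \<Longrightarrow> P m \<Longrightarrow> P (p ^ a * m)"
  shows "P n"
  using \<open>0 < n\<close>
proof (induction n rule: less_induct)
  case (less n)
  show ?case
  proof (cases "n = 1")
    case True
    then show ?thesis using one by simp
  next
    case False
    then obtain p where p: "prime p" "p dvd n"
      using prime_factor_nat by blast
    from less.prems have "n \<noteq> 0" by simp
    with p have "\<not> is_unit p" by (simp add: prime_nat_iff)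
    then obtain m where m: "n = p ^ multiplicity p n * m" "\<not> p dvd m"
      using multiplicity_decompose'[OF \<open>n \<noteq> 0\<close>] by blast
    have a: "0 < multiplicity p n"
      using p \<open>n \<noteq> 0\<close> by (simp add: prime_multiplicity_gt_zero_iff)
    have m0: "0 < m" using m(1) \<open>n \<noteq> 0\<close> by (cases m) auto
    have "1 < p ^ multiplicity p n"
      using p a prime_gt_1_nat one_less_power by blast
    then have "m < n" using m(1) m0 by (metis mult_less_cancel2 nat_mult_1)
    then show ?thesis
      using step[OF p(1) a m0 m(2)] less.IH[OF _ m0] m(1) by simp
  qed
qed

lemma sum_divisors_coprime_mult:
  fixes a b :: nat and h :: "nat \<Rightarrow> real"
  assumes "coprime a b"
  shows "(\<Sum>d | d dvd a * b. h d) = (\<Sum>d | d dvd a. \<Sum>e | e dvd b. h (d * e))"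
proof -
  have "inj_on (\<lambda>(d, e). d * e) ({d. d dvd a} \<times> {e. e dvd b})"
  proof (rule inj_onI, clarify)
    fix d e d' e' :: nat
    assume *: "d dvd a" "e dvd b" "d' dvd a" "e' dvd b" "d * e = d' * e'"
    have "coprime d e'" "coprime d' e"
      using assms * coprime_divisors by blast+
    then have "d = d'"
      using *(5) by (metis coprime_dvd_mult_left_iff dvd_antisym dvd_triv_left)
    moreover have "coprime e d'" "coprime e' d"
      using \<open>coprime d e'\<close> \<open>coprime d' e\<close> by (simp_all add: coprime_commute)
    then have "e = e'"
      using *(5) by (metis coprime_dvd_mult_right_iff dvd_antisym dvd_triv_right)
    ultimately show "d = d' \<and> e = e'" by simp
  qed
  moreover have "(\<lambda>(d, e). d * e) ` ({d. d dvd a} \<times> {e. e dvd b}) = {d. d dvd a * b}"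
  proof (intro equalityI subsetI)
    fix x assume "x \<in> {d. d dvd a * b}"
    then show "x \<in> (\<lambda>(d, e). d * e) ` ({d. d dvd a} \<times> {e. e dvd b})"
      by (auto elim!: dvd_productE)
  qed (auto intro: mult_dvd_mono)
  ultimately have "(\<Sum>d | d dvd a * b. h d)
      = (\<Sum>x \<in> {d. d dvd a} \<times> {e. e dvd b}. h ((\<lambda>(d, e). d * e) x))"
    by (metis (no_types, lifting) sum.reindex_cong)
  then show ?thesis
    by (simp add: sum.cartesian_product case_prod_unfold)
qed

lemma sum_divisors_prime_power:
  fixes p :: nat and h :: "nat \<Rightarrow> real"
  assumes "prime p"
  shows "(\<Sum>d | d dvd p ^ a. h d) = (\<Sum>j\<le>a. h (p ^ j))"
proof -
  have "{d. d dvd p ^ a} = (\<lambda>j. p ^ j) ` {..a}"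
    using divides_primepow_nat[OF assms] by auto
  moreover have "inj_on (\<lambda>j. p ^ j) {..a}"
    using prime_gt_1_nat[OF assms] by (auto intro: inj_onI)
  ultimately show ?thesis by (simp add: sum.reindex)
qed

lemma Omega_total_mult:
  assumes "0 < m" "0 < n"
  shows "Omega_total (m * n) = Omega_total m + Omega_total n"
  using assms by (simp add: Omega_total_def prime_factorization_mult)

lemma Omega_total_prime_power:
  assumes "prime p"
  shows "Omega_total (p ^ a) = a"
  using assms by (simp add: Omega_total_def prime_factorization_prime_power)

text \<open>
  The weight \<open>1 / d\<close> is part of the definition, so that \<open>dsum (\<lambda>_. 1) n\<close> is \<open>\<sigma>(n) / n\<close> and
  \<open>dsum f n / dsum (\<lambda>_. 1) n\<close> is the mean of \<open>f\<close> over the divisors of \<open>n\<close>. For these weights the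
  parts of \<open>d\<close> that belong to coprime factors of \<open>n\<close> are independent.
\<close>

definition dsum :: "(nat \<Rightarrow> real) \<Rightarrow> nat \<Rightarrow> real" where
  "dsum f n = (\<Sum>d | d dvd n. f d / real d)"

text \<open>
  The two main instances are \<open>g = ln\<close>, which is Davenport's function, and \<open>g = 1\<close>, which is
  the sum \<open>r(n)\<close> of the reciprocals of the primes dividing \<open>n\<close>.
\<close>

definition prime_sum :: "(nat \<Rightarrow> real) \<Rightarrow> nat \<Rightarrow> real" where
  "prime_sum g n = (\<Sum>p \<in> prime_factors n. g p / real p)"

abbreviation ln_nat :: "nat \<Rightarrow> real" where
  "ln_nat d \<equiv> ln (real d)"

abbreviation Om :: "nat \<Rightarrow> real" where
  "Om d \<equiv> real (Omega_total d)"

text \<open>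
  One lemma serves the constant 1, an additive function and a product of two additive functions,
  for which \<open>h (d * e)\<close> separates into one, two and four products.
\<close>

lemma dsum_coprime_mult:
  assumes "coprime a b" "0 < a" "0 < b"
    and split: "\<And>d e. 0 < d \<Longrightarrow> 0 < e \<Longrightarrow> h (d * e) = (\<Sum>i\<in>I. f i d * g i e)"
  shows "dsum h (a * b) = (\<Sum>i\<in>I. dsum (f i) a * dsum (g i) b)"
proof -
  have "dsum h (a * b) = (\<Sum>d | d dvd a. \<Sum>e | e dvd b. \<Sum>i\<in>I. (f i d / d) * (g i e / e))"
    unfolding dsum_def sum_divisors_coprime_mult[OF assms(1)]
  proof (intro sum.cong refl, clarify)
    fix d e assume "d dvd a" "e dvd b"
    then have "0 < d" "0 < e" using assms(2,3) by (auto intro: dvd_pos_nat)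
    then show "h (d * e) / real (d * e) = (\<Sum>i\<in>I. (f i d / d) * (g i e / e))"
      by (simp add: split sum_divide_distrib)
  qed
  also have "\<dots> = (\<Sum>i\<in>I. \<Sum>d | d dvd a. \<Sum>e | e dvd b. (f i d / d) * (g i e / e))"
    by (subst sum.swap[of _ _ I], subst sum.swap[of _ I]) (rule refl)
  also have "\<dots> = (\<Sum>i\<in>I. dsum (f i) a * dsum (g i) b)"
    by (simp add: dsum_def sum_product)
  finally show ?thesis .
qed

lemma dsum_one_mult:
  assumes "coprime a b" "0 < a" "0 < b"
  shows "dsum (\<lambda>_. 1) (a * b) = dsum (\<lambda>_. 1) a * dsum (\<lambda>_. 1) b"
  using dsum_coprime_mult[OF assms, of "\<lambda>_. 1" "\<lambda>_ _. 1" "\<lambda>_ _. 1" "{()}"] by simp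

lemma dsum_additive_mult:
  assumes "coprime a b" "0 < a" "0 < b"
    and add: "\<And>d e. 0 < d \<Longrightarrow> 0 < e \<Longrightarrow> f (d * e) = f d + f e"
  shows "dsum f (a * b) = dsum f a * dsum (\<lambda>_. 1) b + dsum (\<lambda>_. 1) a * dsum f b"
  using dsum_coprime_mult[OF assms(1-3), of f
      "\<lambda>i. if i then f else (\<lambda>_. 1)" "\<lambda>i. if i then (\<lambda>_. 1) else f" UNIV]
  by (simp add: add UNIV_bool add.commute)

lemma dsum_additive_product_mult:
  assumes "coprime a b" "0 < a" "0 < b"
    and f: "\<And>d e. 0 < d \<Longrightarrow> 0 < e \<Longrightarrow> f (d * e) = f d + f e"
    and g: "\<And>d e. 0 < d \<Longrightarrow> 0 < e \<Longrightarrow> g (d * e) = g d + g e"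
  shows "dsum (\<lambda>d. f d * g d) (a * b) =
      dsum (\<lambda>d. f d * g d) a * dsum (\<lambda>_. 1) b + dsum f a * dsum g b
      + dsum g a * dsum f b + dsum (\<lambda>_. 1) a * dsum (\<lambda>d. f d * g d) b"
proof -
  define F where "F = (\<lambda>i::nat. [\<lambda>d. f d * g d, f, g, \<lambda>_. 1] ! i)"
  define G where "G = (\<lambda>i::nat. [\<lambda>_. 1, g, f, \<lambda>d. f d * g d] ! i)"
  have I: "{..<4} = {0, 1, 2, 3::nat}" by auto
  have "dsum (\<lambda>d. f d * g d) (a * b) = (\<Sum>i<4. dsum (F i) a * dsum (G i) b)"
    by (rule dsum_coprime_mult[OF assms(1-3)])
      (simp add: f g I F_def G_def numeral_2_eq_2 numeral_3_eq_3 algebra_simps)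
  then show ?thesis
    by (simp add: I F_def G_def numeral_2_eq_2 numeral_3_eq_3)
qed

lemma dsum_one_ge_1:
  assumes "0 < n"
  shows "1 \<le> dsum (\<lambda>_. 1) n"
proof -
  have "(\<Sum>d \<in> {1}. 1 / real d) \<le> dsum (\<lambda>_. 1) n"
    unfolding dsum_def using assms by (intro sum_mono2) auto
  then show ?thesis by simp
qed

lemma prime_sum_mult:
  assumes "prime p" "0 < a" "0 < m" "\<not> p dvd m"
  shows "prime_sum g (p ^ a * m) = g p / p + prime_sum g m"
proof -
  have "prime_factors (p ^ a * m) = insert p (prime_factors m)"
    using assms by (simp add: prime_factors_product prime_factorization_prime_power
        prime_factorization_mult)
  moreover have "p \<notin> prime_factors m"
    using assms(4) by auto
  ultimately show ?thesis by (simp add: prime_sum_def)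
qed

lemma coprime_prime_power_left:
  assumes "prime (p::nat)" "\<not> p dvd m"
  shows "coprime (p ^ a) m"
  using prime_imp_coprime[OF assms] by simp

lemma sum_squares_over_powers_of_2:
  "(\<Sum>j\<le>a. (real j)\<^sup>2 / 2 ^ j) \<le> 6"
proof -
  have "(\<Sum>j\<le>a. (real j)\<^sup>2 / 2 ^ j) = 6 - ((real a)\<^sup>2 + 4 * a + 6) / 2 ^ a"
    by (induction a) (simp_all add: field_simps power2_eq_square)
  then show ?thesis by simp
qed

text \<open>
  The term \<open>j = 0\<close> vanishes, so a factor \<open>1 / p\<close> can be taken out and the remaining powers of \<open>p\<close>
  compared with powers of 2, whatever the exponent \<open>a\<close>.
\<close>

lemma sum_squares_over_prime_powers:
  assumes "prime p"
  shows "(\<Sum>j\<le>a. (real j)\<^sup>2 / real p ^ j) \<le> 12 / p"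
proof -
  have p: "2 \<le> real p" using prime_ge_2_nat[OF assms] by simp
  have "(real j)\<^sup>2 / real p ^ j \<le> (2 / p) * ((real j)\<^sup>2 / 2 ^ j)" for j
  proof (cases j)
    case (Suc i)
    have "2 ^ i \<le> real p ^ i" using p by (intro power_mono) auto
    then have "1 / real p ^ i \<le> 1 / 2 ^ i" by (intro divide_left_mono) (use p in auto)
    then have "(real j)\<^sup>2 / p * (1 / real p ^ i) \<le> (real j)\<^sup>2 / p * (1 / 2 ^ i)"
      by (intro mult_left_mono) auto
    then show ?thesis by (simp add: Suc)
  qed simp
  then have "(\<Sum>j\<le>a. (real j)\<^sup>2 / real p ^ j) \<le> (2 / p) * (\<Sum>j\<le>a. (real j)\<^sup>2 / 2 ^ j)"
    unfolding sum_distrib_left by (intro sum_mono) auto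
  also have "\<dots> \<le> (2 / p) * 6"
    by (intro mult_left_mono sum_squares_over_powers_of_2) auto
  finally show ?thesis by simp
qed

lemma dsum_prime_power_le:
  assumes p: "prime p" and "0 \<le> c"
    and f: "\<And>j. f (p ^ j) \<le> c * (real j)\<^sup>2"
  shows "dsum f (p ^ a) \<le> 12 * (c / p)"
proof -
  have "dsum f (p ^ a) \<le> (\<Sum>j\<le>a. c * ((real j)\<^sup>2 / real p ^ j))"
    unfolding dsum_def sum_divisors_prime_power[OF p]
    using f by (intro sum_mono) (simp add: divide_right_mono)
  also have "\<dots> \<le> c * (12 / p)"
    unfolding sum_distrib_left[symmetric]
    using sum_squares_over_prime_powers[OF p] \<open>0 \<le> c\<close> by (intro mult_left_mono) auto
  finally show ?thesis by (simp add: mult.commute)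
qed

lemma of_nat_le_square: "real j \<le> (real j)\<^sup>2"
  by (cases j) (auto simp: power2_eq_square)

text \<open>
  At \<open>p ^ j\<close> the three functions are \<open>j ln p\<close>, \<open>j\<close> and \<open>j\<^sup>2 ln p\<close>. All are at most \<open>j\<^sup>2\<close>
  times \<open>ln p\<close> or 1, so one convergent series serves for the three of them.
\<close>

lemma dsum_prime_power_bounds:
  assumes p: "prime p"
  shows "dsum ln_nat (p ^ a) \<le> 12 * (ln_nat p / p)"
    and "dsum Om (p ^ a) \<le> 12 * (1 / p)"
    and "dsum (\<lambda>d. ln_nat d * Om d) (p ^ a) \<le> 12 * (ln_nat p / p)"
proof -
  have l: "0 \<le> ln_nat p" and p0: "0 < p" using prime_gt_0_nat[OF p] by auto
  show "dsum ln_nat (p ^ a) \<le> 12 * (ln_nat p / p)"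
    using l p0 mult_right_mono[OF of_nat_le_square l]
    by (intro dsum_prime_power_le[OF p]) (auto simp: ln_realpow mult.commute)
  show "dsum Om (p ^ a) \<le> 12 * (1 / p)"
    using of_nat_le_square
    by (intro dsum_prime_power_le[OF p]) (simp_all only: Omega_total_prime_power[OF p] mult_1_left zero_le_one)
  show "dsum (\<lambda>d. ln_nat d * Om d) (p ^ a) \<le> 12 * (ln_nat p / p)"
    using l p0 by (intro dsum_prime_power_le[OF p])
      (auto simp: Omega_total_prime_power[OF p] ln_realpow power2_eq_square)
qed

text \<open>
  The mean of an additive function over the divisors of \<open>n\<close> is the sum of its means over the
  divisors of the prime powers in \<open>n\<close>; and on a prime power the mean is at most the sum itself,
  because \<open>dsum (\<lambda>_. 1) (p ^ a)\<close> is at least 1.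
\<close>

lemma dsum_additive_le:
  assumes add: "\<And>d e. 0 < d \<Longrightarrow> 0 < e \<Longrightarrow> f (d * e) = f d + f e"
    and pp: "\<And>p a. prime p \<Longrightarrow> dsum f (p ^ a) \<le> 12 * (g p / p)"
    and g: "\<And>p. prime p \<Longrightarrow> 0 \<le> g p"
    and "0 < n"
  shows "dsum f n \<le> 12 * prime_sum g n * dsum (\<lambda>_. 1) n"
  using \<open>0 < n\<close>
proof (induction n rule: coprime_prime_power_induct)
  case one
  have "f 1 = 0" using add[of 1 1] by simp
  then show ?case by (simp add: dsum_def prime_sum_def)
next
  case (prime_power p a m)
  have cop: "coprime (p ^ a) m" "0 < p ^ a" "0 < m"
    using prime_power coprime_prime_power_left prime_gt_0_nat by auto
  define A B where "A = dsum (\<lambda>_. 1) (p ^ a)" and "B = dsum (\<lambda>_. 1) m"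
  have AB: "1 \<le> A" "1 \<le> B"
    using dsum_one_ge_1 cop unfolding A_def B_def by blast+
  have "dsum f (p ^ a * m) = dsum f (p ^ a) * B + A * dsum f m"
    using dsum_additive_mult[OF cop add] by (simp add: A_def B_def)
  also have "\<dots> \<le> (12 * (g p / p) * A) * B + A * (12 * prime_sum g m * B)"
  proof (intro add_mono mult_right_mono mult_left_mono)
    have "12 * (g p / p) * 1 \<le> 12 * (g p / p) * A"
      using AB g[OF prime_power(1)] by (intro mult_left_mono) auto
    then show "dsum f (p ^ a) \<le> 12 * (g p / p) * A"
      using pp[OF prime_power(1), of a] by simp
    show "dsum f m \<le> 12 * prime_sum g m * B"
      using prime_power by (simp add: B_def)
  qed (use AB in auto)
  also have "\<dots> = 12 * prime_sum g (p ^ a * m) * dsum (\<lambda>_. 1) (p ^ a * m)"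
    unfolding prime_sum_mult[OF prime_power(1-4)] dsum_one_mult[OF cop] A_def B_def
    by (simp add: algebra_simps)
  finally show ?case .
qed

lemma ln_nat_mult: "0 < d \<Longrightarrow> 0 < e \<Longrightarrow> ln_nat (d * e) = ln_nat d + ln_nat e"
  by (simp add: ln_mult)

lemma Om_mult: "0 < d \<Longrightarrow> 0 < e \<Longrightarrow> Om (d * e) = Om d + Om e"
  by (simp add: Omega_total_mult)

lemma dsum_ln_le:
  assumes "0 < n"
  shows "dsum ln_nat n \<le> 12 * prime_sum ln_nat n * dsum (\<lambda>_. 1) n"
  using dsum_prime_power_bounds(1) prime_gt_0_nat assms
  by (intro dsum_additive_le[OF ln_nat_mult]) (auto simp: Suc_le_eq)

lemma dsum_Om_le:
  assumes "0 < n"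
  shows "dsum Om n \<le> 12 * prime_sum (\<lambda>_. 1) n * dsum (\<lambda>_. 1) n"
  using dsum_prime_power_bounds(2) assms
  by (intro dsum_additive_le[OF Om_mult]) auto

lemma prime_sum_nonneg:
  assumes "\<And>p. prime p \<Longrightarrow> 0 \<le> g p"
  shows "0 \<le> prime_sum g n"
  unfolding prime_sum_def using assms by (intro sum_nonneg divide_nonneg_nonneg) auto

lemma ln_nat_prime_nonneg: "prime p \<Longrightarrow> 0 \<le> ln_nat p"
  using prime_gt_0_nat[of p] by (auto simp: Suc_le_eq)

text \<open>
  The mean of the product of \<open>ln\<close> and \<open>\<Omega>\<close> is bounded by the product of their means plus a
  covariance. The covariance is a sum over primes, since different primes are independent, and
  it only adds a multiple of \<open>w(n)\<close>: this is the 1 in the factor \<open>1 + r(n)\<close>. In the induction the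
  two mixed terms each carry \<open>12 * 12 = 144\<close>, which fixes the constant.
\<close>

lemma dsum_ln_Om_le:
  assumes "0 < n"
  shows "dsum (\<lambda>d. ln_nat d * Om d) n
      \<le> 144 * prime_sum ln_nat n * (1 + prime_sum (\<lambda>_. 1) n) * dsum (\<lambda>_. 1) n"
  using assms
proof (induction n rule: coprime_prime_power_induct)
  case one
  then show ?case by (simp add: dsum_def prime_sum_def)
next
  case (prime_power p a m)
  have cop: "coprime (p ^ a) m" "0 < p ^ a" "0 < m"
    using prime_power coprime_prime_power_left prime_gt_0_nat by auto
  define A B where "A = dsum (\<lambda>_. 1) (p ^ a)" and "B = dsum (\<lambda>_. 1) m"
  have AB: "1 \<le> A" "1 \<le> B"
    using dsum_one_ge_1 cop unfolding A_def B_def by blast+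
  define w r where "w = prime_sum ln_nat m" and "r = prime_sum (\<lambda>_. 1) m"
  define u v where "u = ln_nat p / p" and "v = 1 / real p"
  have nn: "0 \<le> w" "0 \<le> r" "0 \<le> u" "0 \<le> v"
    unfolding w_def r_def u_def v_def
    using ln_nat_prime_nonneg prime_power(1) by (auto intro!: prime_sum_nonneg)
  have dnn: "0 \<le> dsum Om k" "0 \<le> dsum ln_nat k" if "0 < k" for k
    using that unfolding dsum_def
    by (auto intro!: sum_nonneg divide_nonneg_nonneg simp: Suc_le_eq dest: dvd_pos_nat)
  have "0 \<le> dsum (\<lambda>d. ln_nat d * Om d) m"
    using cop(3) unfolding dsum_def
    by (auto intro!: sum_nonneg divide_nonneg_nonneg mult_nonneg_nonneg
        simp: Suc_le_eq dest: dvd_pos_nat)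
  note dnn = dnn this
  have scale: "x \<le> y * A" if "x \<le> y" "0 \<le> y" for x y :: real
    using that AB mult_left_mono[of 1 A y] by simp
  have "dsum (\<lambda>d. ln_nat d * Om d) (p ^ a * m) =
      dsum (\<lambda>d. ln_nat d * Om d) (p ^ a) * B + dsum ln_nat (p ^ a) * dsum Om m
      + dsum Om (p ^ a) * dsum ln_nat m + A * dsum (\<lambda>d. ln_nat d * Om d) m"
    using dsum_additive_product_mult[OF cop ln_nat_mult Om_mult] by (simp add: A_def B_def)
  also have "\<dots> \<le> (12 * u * A) * B + (12 * u * A) * (12 * r * B)
      + (12 * v * A) * (12 * w * B) + A * (144 * w * (1 + r) * B)"
  proof (intro add_mono mult_mono mult_left_mono)
    show "dsum (\<lambda>d. ln_nat d * Om d) (p ^ a) \<le> 12 * u * A"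
      using dsum_prime_power_bounds(3)[OF prime_power(1), of a] nn by (intro scale) (auto simp: u_def)
    show "dsum ln_nat (p ^ a) \<le> 12 * u * A"
      using dsum_prime_power_bounds(1)[OF prime_power(1), of a] nn by (intro scale) (auto simp: u_def)
    show "dsum Om (p ^ a) \<le> 12 * v * A"
      using dsum_prime_power_bounds(2)[OF prime_power(1), of a] nn by (intro scale) (auto simp: v_def)
    show "dsum Om m \<le> 12 * r * B" "dsum ln_nat m \<le> 12 * w * B"
      using dsum_Om_le dsum_ln_le prime_power by (auto simp: r_def w_def B_def)
    show "dsum (\<lambda>d. ln_nat d * Om d) m \<le> 144 * w * (1 + r) * B"
      using prime_power by (simp add: r_def w_def B_def)
  qed (use AB nn dnn cop in auto)
  also have "\<dots> = (12 * u + 144 * (u * r + v * w + w * (1 + r))) * (A * B)"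
    by (simp add: algebra_simps)
  also have "\<dots> \<le> (144 * (u + w) * (1 + (v + r))) * (A * B)"
  proof (intro mult_right_mono)
    have "0 \<le> 132 * u + 144 * (u * v)" using nn by simp
    then show "12 * u + 144 * (u * r + v * w + w * (1 + r)) \<le> 144 * (u + w) * (1 + (v + r))"
      by (simp add: algebra_simps)
  qed (use AB in auto)
  also have "\<dots> = 144 * prime_sum ln_nat (p ^ a * m) * (1 + prime_sum (\<lambda>_. 1) (p ^ a * m))
      * dsum (\<lambda>_. 1) (p ^ a * m)"
    using prime_power by (simp add: prime_sum_mult dsum_one_mult[OF cop] A_def B_def u_def v_def w_def r_def)
  finally show ?case .
qed

section \<open>Upper bounds of Chebyshev and Mertens\<close>

lemma prod_primes_dvd:
  fixes m :: nat
  assumes "finite P" "\<And>p. p \<in> P \<Longrightarrow> prime p" "\<And>p. p \<in> P \<Longrightarrow> p dvd m"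
  shows "\<Prod>P dvd m"
  using assms
proof (induction P rule: finite_induct)
  case (insert p P)
  have "coprime p (\<Prod>P)"
    using insert by (intro prod_coprime_right) (metis insertCI primes_coprime)
  then show ?case using insert by (simp add: divides_mult)
qed simp

lemma sum_ln_primes_le:
  fixes m :: nat
  assumes "finite P" "\<And>p. p \<in> P \<Longrightarrow> prime p" "\<And>p. p \<in> P \<Longrightarrow> p dvd m" "0 < m"
  shows "(\<Sum>p\<in>P. ln (real p)) \<le> ln (real m)"
proof -
  have "0 < \<Prod>P" using assms(1,2) prime_gt_0_nat by (intro prod_pos) auto
  moreover have "\<Prod>P \<le> m"
    using prod_primes_dvd[OF assms(1-3)] \<open>0 < m\<close> by (intro dvd_imp_le) auto
  ultimately have "ln (real (\<Prod>P)) \<le> ln (real m)" by (simp del: of_nat_prod)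
  moreover have "ln (real (\<Prod>P)) = (\<Sum>p\<in>P. ln (real p))"
    unfolding of_nat_prod using assms(1,2) prime_gt_0_nat by (intro ln_prod) fastforce+
  ultimately show ?thesis by simp
qed

text \<open>
  Such a prime divides \<open>n!\<close> but neither factorial in the denominator.
\<close>

lemma prime_dvd_binomial:
  fixes p :: nat
  assumes "prime p" "k \<le> n - k" "n - k < p" "p \<le> n"
  shows "p dvd n choose k"
proof -
  have "k \<le> n" using assms by simp
  then have "p dvd fact k * fact (n - k) * (n choose k)"
    using assms by (simp add: binomial_fact_lemma prime_dvd_fact_iff)
  then show ?thesis
    using assms by (simp add: prime_dvd_mult_iff prime_dvd_fact_iff)
qed

text \<open>
  Chebyshev's argument: the primes in \<open>(n - k, n]\<close>, where \<open>k\<close> is half of \<open>n\<close>, all divide a binomial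
  coefficient that is at most \<open>2 ^ n\<close>, and the primes up to \<open>n - k\<close> are covered by induction. The
  constant 3 makes the induction close, since \<open>n \<le> 3 * (n div 2)\<close> for \<open>n \<ge> 2\<close>.
\<close>

lemma chebyshev_theta_le:
  "(\<Sum>p | prime p \<and> p \<le> n. ln (real p)) \<le> 3 * ln 2 * real n"
proof (induction n rule: less_induct)
  case (less n)
  show ?case
  proof (cases "2 \<le> n")
    case False
    then have empty: "{p. prime p \<and> p \<le> n} = {}" by (auto dest: prime_ge_2_nat)
    show ?thesis unfolding empty by simp
  next
    case True
    define k where "k = n div 2"
    have k: "k \<le> n - k" "n - k < n" "k \<le> n" "n \<le> 3 * k" using True by (auto simp: k_def)
    let ?P = "{p. prime p \<and> n - k < p \<and> p \<le> n}"
    have "{p. prime p \<and> p \<le> n} = {p. prime p \<and> p \<le> n - k} \<union> ?P" using k by auto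
    then have "(\<Sum>p | prime p \<and> p \<le> n. ln (real p))
        = (\<Sum>p | prime p \<and> p \<le> n - k. ln (real p)) + (\<Sum>p\<in>?P. ln (real p))"
      by (simp add: sum.union_disjoint[symmetric] disjoint_iff)
    also have "\<dots> \<le> 3 * ln 2 * real (n - k) + ln 2 * real n"
    proof (rule add_mono)
      show "(\<Sum>p | prime p \<and> p \<le> n - k. ln (real p)) \<le> 3 * ln 2 * real (n - k)"
        using less k(2) by blast
      have "(\<Sum>p\<in>?P. ln (real p)) \<le> ln (real (n choose k))"
        using k prime_dvd_binomial by (intro sum_ln_primes_le) auto
      also have "\<dots> \<le> ln (real (2 ^ n))"
        using k by (subst ln_le_cancel_iff) (auto simp: binomial_le_pow2 zero_less_binomial_iff simp del: of_nat_power)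
      finally show "(\<Sum>p\<in>?P. ln (real p)) \<le> ln 2 * real n" by (simp add: ln_realpow mult.commute)
    qed
    also have "\<dots> \<le> 3 * ln 2 * real n"
    proof -
      have "ln 2 * real n \<le> ln 2 * (3 * real k)" using k by (intro mult_left_mono) auto
      then show ?thesis using k by (simp add: of_nat_diff algebra_simps)
    qed
    finally show ?thesis .
  qed
qed

text \<open>
  Passing from \<open>n\<close> to \<open>n + 1\<close> raises \<open>n div p\<close> by one exactly when \<open>p\<close> divides \<open>n + 1\<close>, and the
  logarithms of the distinct primes dividing \<open>n + 1\<close> add up to at most \<open>ln (n + 1)\<close>.
\<close>

lemma sum_ln_div_le_ln_fact:
  fixes P :: "nat set"
  assumes "finite P" "\<And>p. p \<in> P \<Longrightarrow> prime p"
  shows "(\<Sum>p\<in>P. ln (real p) * real (n div p)) \<le> ln (fact n)"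
proof (induction n)
  case (Suc n)
  have "(\<Sum>p\<in>P. ln (real p) * real (Suc n div p))
      = (\<Sum>p\<in>P. ln (real p) * real (n div p) + (if p dvd Suc n then ln (real p) else 0))"
    by (intro sum.cong refl) (auto simp: div_Suc dvd_eq_mod_eq_0 algebra_simps)
  also have "\<dots> = (\<Sum>p\<in>P. ln (real p) * real (n div p)) + (\<Sum>p\<in>{p\<in>P. p dvd Suc n}. ln (real p))"
    using assms(1) by (simp add: sum.distrib sum.inter_filter)
  also have "\<dots> \<le> ln (fact n) + ln (real (Suc n))"
    using assms by (intro add_mono Suc sum_ln_primes_le) auto
  also have "\<dots> = ln (fact (Suc n))"
    unfolding fact_Suc of_nat_mult using fact_gt_zero[of n, where 'a = real]
    by (subst ln_mult) (auto simp: add.commute)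
  finally show ?case .
qed simp

text \<open>
  Replacing \<open>n / p\<close> by \<open>n div p\<close> costs at most 1 for each prime, in total Chebyshev's
  \<open>\<theta>(n) = O(n)\<close>; what is left is at most \<open>ln n! \<le> n ln n\<close>.
\<close>

lemma mertens_first_upper:
  assumes "0 < n"
  shows "(\<Sum>p | prime p \<and> p \<le> n. ln (real p) / real p) \<le> ln (real n) + 3 * ln 2"
proof -
  let ?P = "{p. prime p \<and> p \<le> n}"
  have "real n * (ln (real p) / real p) \<le> ln (real p) * real (n div p) + ln (real p)"
    if "p \<in> ?P" for p
  proof -
    have p: "0 < p" using that prime_gt_0_nat by auto
    have "n \<le> (n div p + 1) * p" using dividend_less_div_times[OF p, of n] by simp
    then have "real n \<le> real ((n div p + 1) * p)" by (simp only: of_nat_le_iff)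
    then have "real n / real p \<le> real (n div p) + 1"
      using p by (simp add: divide_le_eq algebra_simps)
    then have "ln (real p) * (real n / real p) \<le> ln (real p) * (real (n div p) + 1)"
      using p by (intro mult_left_mono) auto
    then show ?thesis by (simp add: algebra_simps)
  qed
  then have "real n * (\<Sum>p\<in>?P. ln (real p) / real p)
      \<le> (\<Sum>p\<in>?P. ln (real p) * real (n div p)) + (\<Sum>p\<in>?P. ln (real p))"
    unfolding sum_distrib_left sum.distrib[symmetric] by (intro sum_mono) blast
  also have "\<dots> \<le> ln (fact n) + 3 * ln 2 * real n"
    by (intro add_mono sum_ln_div_le_ln_fact chebyshev_theta_le) auto
  also have "ln (fact n) \<le> ln (real (n ^ n))"
    using fact_le_power[of n, where 'a = real] assms by (subst ln_le_cancel_iff) auto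
  also have "ln (real (n ^ n)) = real n * ln (real n)"
    using assms by (simp add: ln_realpow)
  finally have "real n * (\<Sum>p\<in>?P. ln (real p) / real p) \<le> real n * (ln (real n) + 3 * ln 2)"
    by (simp add: algebra_simps)
  then show ?thesis using assms by simp
qed

lemma sum_primes_le_Suc:
  fixes g :: "nat \<Rightarrow> real"
  shows "(\<Sum>p | prime p \<and> p \<le> Suc n. g p)
    = (\<Sum>p | prime p \<and> p \<le> n. g p) + (if prime (Suc n) then g (Suc n) else 0)"
proof -
  have "{p. prime p \<and> p \<le> Suc n} = {p. prime p \<and> p \<le> n} \<union> (if prime (Suc n) then {Suc n} else {})"
    by (auto simp: le_Suc_eq)
  then show ?thesis by (auto simp: add.commute)
qed

text \<open>
  One step of the partial summation that passes from \<open>\<Sum> ln p / p\<close> to \<open>\<Sum> 1 / p\<close>: here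
  \<open>x = ln n\<close>, \<open>y = ln (n + 1)\<close>, and \<open>S\<close> is the sum of \<open>ln p / p\<close> up to \<open>n\<close>. The bound telescopes
  in \<open>n\<close>.
\<close>

lemma mertens_abel_step:
  fixes c x y S :: real
  assumes "0 < x" "x \<le> y" "S \<le> x + c"
  shows "S / x - S / y \<le> (ln y - ln x) + (c / x - c / y)"
proof -
  have "S / x - S / y = S * (1 / x - 1 / y)" by (simp add: algebra_simps)
  also have "\<dots> \<le> (x + c) * (1 / x - 1 / y)"
    using assms by (intro mult_right_mono) (auto simp: frac_le)
  also have "\<dots> = (1 - x / y) + (c / x - c / y)"
    using assms by (simp add: field_simps)
  also have "1 - x / y \<le> ln y - ln x"
    using ln_le_minus_one[of "x / y"] assms by (simp add: ln_div)
  finally show ?thesis by simp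
qed

text \<open>
  By the preceding lemma, \<open>\<Sum> 1 / p - (\<Sum> ln p / p) / ln n + c / ln n - ln ln n\<close> does not
  increase with \<open>n\<close>, so it stays below its value at 2; and the second term is at most
  \<open>1 + c / ln n\<close>.
\<close>

lemma mertens_second_upper:
  obtains C :: real where "0 \<le> C"
    "\<And>n. 2 \<le> n \<Longrightarrow> (\<Sum>p | prime p \<and> p \<le> n. 1 / real p) \<le> ln (ln (real n)) + C"
proof -
  define R A where "R = (\<lambda>n. \<Sum>p | prime p \<and> p \<le> n. 1 / real p)"
    and "A = (\<lambda>n. \<Sum>p | prime p \<and> p \<le> n. ln (real p) / real p)"
  define c where "c = 3 * ln (2::real)"
  define D where "D = (\<lambda>n. R n - A n / ln (real n) + c / ln (real n) - ln (ln (real n)))"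
  have A_le: "A n \<le> ln (real n) + c" if "0 < n" for n
    using mertens_first_upper[OF that] by (simp add: A_def c_def)
  have D_le: "D n \<le> D 2" if "2 \<le> n" for n
    using that
  proof (induction n rule: dec_induct)
    case (step n)
    have pos: "0 < ln (real n)" "0 < ln (real (Suc n))" "ln (real n) \<le> ln (real (Suc n))"
      using step by auto
    have "R (Suc n) - A (Suc n) / ln (real (Suc n)) = R n - A n / ln (real (Suc n))"
      using pos(2) by (simp add: R_def A_def sum_primes_le_Suc add_divide_distrib)
    then have "D (Suc n) \<le> D n"
      using mertens_abel_step[OF pos(1,3) A_le[of n]] step unfolding D_def by auto
    then show ?case using step by simp
  qed simp
  have "R n \<le> ln (ln (real n)) + max 0 (1 + D 2)" if "2 \<le> n" for n
  proof -
    have pos: "0 < ln (real n)" using that by auto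
    have "A n / ln (real n) \<le> (ln (real n) + c) / ln (real n)"
      using A_le[of n] that pos by (intro divide_right_mono) auto
    also have "\<dots> = 1 + c / ln (real n)" using pos by (simp add: field_simps)
    finally show ?thesis using D_le[OF that] unfolding D_def by simp
  qed
  then show thesis by (intro that[of "max 0 (1 + D 2)"]) (auto simp: R_def)
qed

section \<open>Bounds in terms of the number of prime divisors\<close>

text \<open>
  \<open>\<sigma>(n) / n\<close> is at most the Euler product of \<open>1 / (1 - 1 / p) = 1 + 1 / (p - 1)\<close> over \<open>p\<close> dividing \<open>n\<close>.
  The function \<open>p / (p - 1)\<close> is chosen so that \<open>prime_sum\<close>, which divides by \<open>p\<close>, has the terms
  \<open>1 / (p - 1)\<close>.
\<close>

lemma dsum_one_le_exp:
  assumes "0 < n"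
  shows "dsum (\<lambda>_. 1) n \<le> exp (prime_sum (\<lambda>p. real p / (real p - 1)) n)"
  using assms
proof (induction n rule: coprime_prime_power_induct)
  case one
  then show ?case by (simp add: dsum_def prime_sum_def)
next
  case (prime_power p a m)
  have cop: "coprime (p ^ a) m" "0 < p ^ a" "0 < m"
    using prime_power coprime_prime_power_left prime_gt_0_nat by auto
  have p: "2 \<le> real p" using prime_ge_2_nat[OF prime_power(1)] by simp
  have "dsum (\<lambda>_. 1) (p ^ a) = (\<Sum>j\<le>a. (1 / real p) ^ j)"
    unfolding dsum_def sum_divisors_prime_power[OF prime_power(1)] by (simp add: power_one_over)
  also have "\<dots> \<le> 1 / (1 - 1 / real p)"
    using p by (simp add: sum_gp0 divide_right_mono)
  also have "\<dots> = 1 + 1 / (real p - 1)" using p by (simp add: field_simps)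
  also have "\<dots> \<le> exp (1 / (real p - 1))" by (rule exp_ge_add_one_self)
  finally have "dsum (\<lambda>_. 1) (p ^ a) \<le> exp (1 / (real p - 1))" .
  then have "dsum (\<lambda>_. 1) (p ^ a * m)
      \<le> exp (1 / (real p - 1)) * exp (prime_sum (\<lambda>p. real p / (real p - 1)) m)"
    unfolding dsum_one_mult[OF cop] using prime_power.IH dsum_one_ge_1[OF cop(3)]
    by (intro mult_mono) auto
  then show ?case
    unfolding prime_sum_mult[OF prime_power(1-4)] exp_add using p by simp
qed

lemma sum_pronic_reciprocals_le_1:
  fixes P :: "nat set"
  assumes "finite P" "\<And>p. p \<in> P \<Longrightarrow> 2 \<le> p"
  shows "(\<Sum>p\<in>P. 1 / (real p * (real p - 1))) \<le> 1"
proof -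
  obtain N where N: "\<forall>p\<in>P. p \<le> N" using assms(1) finite_nat_set_iff_bounded_le by blast
  have telescope: "(\<Sum>p\<in>{2..Suc k}. 1 / (real p * (real p - 1))) = 1 - 1 / real (Suc k)" for k
  proof (induction k)
    case (Suc k)
    have split: "1 / ((x + 1) * x) = 1 / x - 1 / (x + 1)" if "0 < x" for x :: real
      using that by (simp add: field_simps)
    have "(\<Sum>p\<in>{2..Suc (Suc k)}. 1 / (real p * (real p - 1)))
        = (1 - 1 / real (Suc k)) + 1 / (real (Suc (Suc k)) * (real (Suc (Suc k)) - 1))"
      using Suc by simp
    also have "\<dots> = 1 - 1 / real (Suc (Suc k))"
      using split[of "real (Suc k)"] by (simp add: add.commute)
    finally show ?case .
  qed simp
  have "(\<Sum>p\<in>P. 1 / (real p * (real p - 1))) \<le> (\<Sum>p\<in>{2..Suc N}. 1 / (real p * (real p - 1)))"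
    using N assms(2) by (intro sum_mono2) force+
  also have "\<dots> \<le> 1" unfolding telescope by simp
  finally show ?thesis .
qed

lemma prime_sum_shifted_le:
  "prime_sum (\<lambda>p. real p / (real p - 1)) n \<le> prime_sum (\<lambda>_. 1) n + 1"
proof -
  have p: "2 \<le> p" if "p \<in> prime_factors n" for p
    using that by (auto intro: prime_ge_2_nat)
  \<comment> \<open>partial fractions: \<open>1 / (p - 1) = 1 / p + 1 / (p (p - 1))\<close>\<close>
  have "real p / (real p - 1) / real p = 1 / real p + 1 / (real p * (real p - 1))"
    if "p \<in> prime_factors n" for p
    using p[OF that] by (simp add: field_simps)
  then have "prime_sum (\<lambda>p. real p / (real p - 1)) n
      = prime_sum (\<lambda>_. 1) n + (\<Sum>p\<in>prime_factors n. 1 / (real p * (real p - 1)))"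
    unfolding prime_sum_def sum.distrib[symmetric] by (intro sum.cong) auto
  then show ?thesis using sum_pronic_reciprocals_le_1[OF _ p] by simp
qed

text \<open>
  Put \<open>k = \<omega>(n)\<close>. The primes dividing \<open>n\<close> that exceed \<open>k\<close> are at most \<open>k\<close> in number and
  contribute less than \<open>1 / k\<close> each, so together at most 1; the others contribute at most the sum
  over all primes up to \<open>k\<close>.
\<close>

lemma prime_sum_one_le:
  obtains C :: real where "0 \<le> C"
    "\<And>n. prime_sum (\<lambda>_. 1) n \<le> ln (log1 (real (omega_distinct n))) + C"
proof -
  obtain C where C: "0 \<le> C"
    "\<And>k. 2 \<le> k \<Longrightarrow> (\<Sum>p | prime p \<and> p \<le> k. 1 / real p) \<le> ln (ln (real k)) + C"
    using mertens_second_upper by blast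
  have "prime_sum (\<lambda>_. 1) n \<le> ln (log1 (real (omega_distinct n))) + (C + 1)" for n
  proof -
    define k where "k = omega_distinct n"
    let ?P = "prime_factors n"
    have card: "card ?P = k" by (simp add: k_def omega_distinct_def)
    show ?thesis
    proof (cases "2 \<le> k")
      case True
      have "prime_sum (\<lambda>_. 1) n
          = (\<Sum>p\<in>{p\<in>?P. p \<le> k}. 1 / real p) + (\<Sum>p\<in>{p\<in>?P. k < p}. 1 / real p)"
        unfolding prime_sum_def
        by (subst sum.union_disjoint[symmetric]) (auto intro!: sum.cong)
      also have "\<dots> \<le> (ln (ln (real k)) + C) + 1"
      proof (rule add_mono)
        have "(\<Sum>p\<in>{p\<in>?P. p \<le> k}. 1 / real p) \<le> (\<Sum>p | prime p \<and> p \<le> k. 1 / real p)"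
          by (intro sum_mono2) auto
        then show "(\<Sum>p\<in>{p\<in>?P. p \<le> k}. 1 / real p) \<le> ln (ln (real k)) + C"
          using C(2)[OF True] by linarith
        have "(\<Sum>p\<in>{p\<in>?P. k < p}. 1 / real p) \<le> real (card {p\<in>?P. k < p}) * (1 / real k)"
          using True by (intro sum_bounded_above) (auto simp: frac_le)
        also have "\<dots> \<le> real k * (1 / real k)"
          unfolding card[symmetric] by (intro mult_right_mono of_nat_mono card_mono) auto
        finally show "(\<Sum>p\<in>{p\<in>?P. k < p}. 1 / real p) \<le> 1" using True by simp
      qed
      finally show ?thesis using True by (simp add: log1_def k_def)
    next
      case False
      have "prime_sum (\<lambda>_. 1) n \<le> real (card ?P) * 1"
        unfolding prime_sum_def
        by (intro sum_bounded_above) (auto dest!: prime_gt_0_nat simp: Suc_le_eq divide_le_eq_1)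
      then show ?thesis using False C(1) by (auto simp: card log1_def k_def)
    qed
  qed
  then show thesis using C(1) by (intro that[of "C + 1"]) auto
qed

lemma davenport_w_eq_prime_sum:
  assumes "0 < n"
  shows "davenport_w n = prime_sum ln_nat n"
proof -
  have "{p. prime p \<and> p dvd n} = prime_factors n"
    using assms by (auto simp: prime_factors_dvd)
  then show ?thesis by (simp add: davenport_w_def prime_sum_def)
qed

text \<open>
  The concave function \<open>ln\<close> lies below its tangent at \<open>T\<close>, so \<open>ln \<Omega> \<le> ln T + \<Omega> / T - 1\<close>. This
  stands in for Jensen's inequality when \<open>T\<close> is chosen of the size of the mean of \<open>\<Omega>\<close>.
\<close>

lemma Phi2_le_linearised:
  assumes "0 < n" "1 \<le> T"
  shows "Phi2 n \<le> ln T * dsum ln_nat n + dsum (\<lambda>d. ln_nat d * Om d) n / T"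
proof -
  have "ln_nat d * ln (Om d) / d \<le> ln T * (ln_nat d / d) + ln_nat d * Om d / d / T"
    if "d dvd n" for d
  proof (cases "d \<le> 1")
    case True
    then show ?thesis by (cases d) auto
  next
    case False
    have "Omega_total d \<noteq> 0"
      using False prime_factorization_empty_iff[of d] by (auto simp: Omega_total_def)
    then have Om: "0 < Om d" by simp
    then have "ln (Om d) - ln T \<le> Om d / T - 1"
      using ln_le_minus_one[of "Om d / T"] assms(2) by (simp add: ln_div)
    then have "ln_nat d / d * ln (Om d) \<le> ln_nat d / d * (ln T + Om d / T)"
      using False by (intro mult_left_mono) auto
    then show ?thesis by (simp add: algebra_simps)
  qed
  then show ?thesis
    unfolding Phi2_def dsum_def sum_distrib_left sum_divide_distrib sum.distrib[symmetric]
    by (intro sum_mono) auto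
qed

lemma log1_pos: "0 < log1 x"
  by (simp add: log1_def)

lemma logloglog_ge_1: "1 \<le> logloglog x"
proof (cases "x \<le> exp (exp (exp 1))")
  case False
  then have "exp (exp (exp 1)) < x" by simp
  then have "exp (exp 1) < ln x"
    by (metis exp_gt_zero ln_exp ln_less_cancel_iff order_less_trans)
  then have "exp 1 < ln (ln x)"
    by (metis exp_gt_zero ln_exp ln_less_cancel_iff order_less_trans)
  then have "1 < ln (ln (ln x))"
    by (metis exp_gt_zero ln_exp ln_less_cancel_iff order_less_trans)
  then show ?thesis using False by (simp add: logloglog_def)
qed (simp add: logloglog_def)

text \<open>
  Below \<open>e^(e^e)\<close> the quantity \<open>T\<close> is bounded by \<open>e + C\<close>. Above, \<open>ln ln x\<close> is at least 1 and
  absorbs \<open>C\<close> as a factor, whose logarithm is in turn absorbed because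
  \<open>ln ln ln x\<close> is at least 1.
\<close>

lemma ln_lnln_le_logloglog:
  assumes "0 \<le> C" and T: "1 \<le> T" "T \<le> ln (log1 x) + C"
  shows "ln T \<le> (ln (3 + C) + 1) * logloglog x"
proof (cases "x \<le> exp (exp (exp 1))")
  case True
  have "ln (log1 x) \<le> exp 1"
  proof (cases "x \<le> 1")
    case False
    then have "0 < ln x" by simp
    moreover have "ln x \<le> exp (exp 1)"
      using True False by (metis exp_gt_zero ln_exp ln_le_cancel_iff not_le order_less_trans zero_less_one)
    ultimately have "ln (ln x) \<le> exp 1"
      by (metis exp_gt_zero ln_exp ln_le_cancel_iff)
    then show ?thesis using False by (simp add: log1_def)
  qed (simp add: log1_def)
  then have "T \<le> 3 + C" using T exp_le by linarith
  then have "ln T \<le> ln (3 + C)" using T by simp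
  then show ?thesis using True by (simp add: logloglog_def)
next
  case False
  then have x: "exp (exp (exp 1)) < x" by simp
  then have l: "exp (exp 1) < ln x"
    by (metis exp_gt_zero ln_exp ln_less_cancel_iff order_less_trans)
  then have ll: "exp 1 < ln (ln x)"
    by (metis exp_gt_zero ln_exp ln_less_cancel_iff order_less_trans)
  define L where "L = ln (ln x)"
  have L: "1 \<le> L" using ll one_le_exp_iff[of "1::real"] unfolding L_def by linarith
  have "(1::real) \<le> exp (exp (exp 1))" by simp
  then have "1 < x" using x by linarith
  then have "T \<le> L + C" using T(2) by (simp add: log1_def L_def)
  also have "\<dots> \<le> (3 + C) * L"
    using L mult_left_mono[OF L assms(1)] by (simp add: algebra_simps)
  finally have "ln T \<le> ln ((3 + C) * L)" using T by simp
  also have "\<dots> = ln (3 + C) + logloglog x"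
    using L assms(1) False by (simp add: ln_mult logloglog_def L_def)
  also have "\<dots> \<le> ln (3 + C) * logloglog x + logloglog x"
    using logloglog_ge_1[of x] assms(1) mult_left_mono[of 1 "logloglog x" "ln (3 + C)"] by simp
  finally show ?thesis by (simp add: algebra_simps)
qed

theorem theorem1p2:
  "\<exists>C::real. C > 0 \<and> (\<forall>n::nat. n > 0 \<and> odd n \<longrightarrow>
     Phi2 n \<le> C * logloglog (real (omega_distinct n)) * log1 (real (omega_distinct n)) * davenport_w n)"
proof -
  obtain C where C: "0 \<le> C"
    "\<And>n. prime_sum (\<lambda>_. 1) n \<le> ln (log1 (real (omega_distinct n))) + C"
    using prime_sum_one_le by blast
  define K where "K = ln (3 + (C + 1)) + 1"
  have K: "1 \<le> K" using C(1) by (simp add: K_def)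
  define M where "M = exp (C + 1) * (12 * K + 144)"
  have "Phi2 n \<le> M * logloglog (real (omega_distinct n)) * log1 (real (omega_distinct n)) * davenport_w n"
    if "0 < n" for n
  proof -
    define l3 l1 where "l3 = logloglog (real (omega_distinct n))"
      and "l1 = log1 (real (omega_distinct n))"
    define w r F where "w = prime_sum ln_nat n" and "r = prime_sum (\<lambda>_. 1) n"
      and "F = dsum (\<lambda>_. 1) n"
    have w0: "0 \<le> w" and r0: "0 \<le> r"
      unfolding w_def r_def by (auto intro!: prime_sum_nonneg ln_nat_prime_nonneg)
    have l1: "0 < l1" by (simp add: l1_def log1_pos)
    have l3: "1 \<le> l3" by (simp add: l3_def logloglog_ge_1)
    have lnT: "ln (1 + r) \<le> K * l3"
      using C r0 unfolding K_def l3_def r_def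
      by (intro ln_lnln_le_logloglog) (auto simp: add.assoc[symmetric])
    have "F \<le> exp (r + 1)"
      using dsum_one_le_exp[OF that] prime_sum_shifted_le[of n] unfolding F_def r_def
      by (meson exp_le_cancel_iff order_trans)
    also have "\<dots> \<le> exp (ln l1 + (C + 1))" using C(2)[of n] by (simp add: r_def l1_def)
    also have "\<dots> = exp (C + 1) * l1" using l1 by (simp add: exp_add)
    finally have F: "F \<le> exp (C + 1) * l1" .
    have F0: "0 \<le> F" using dsum_one_ge_1[OF that] by (simp add: F_def)
    \<comment> \<open>\<open>T = 1 + r\<close> cancels the factor \<open>1 + r\<close> in the bound for the sum of \<open>ln d * \<Omega>(d)\<close>\<close>
    have "Phi2 n \<le> ln (1 + r) * dsum ln_nat n + dsum (\<lambda>d. ln_nat d * Om d) n / (1 + r)"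
      using r0 by (intro Phi2_le_linearised[OF that]) auto
    also have "\<dots> \<le> (K * l3) * (12 * w * F) + 144 * w * F"
    proof (intro add_mono)
      show "ln (1 + r) * dsum ln_nat n \<le> (K * l3) * (12 * w * F)"
        using dsum_ln_le[OF that] lnT r0 w0 F0 K l3
        by (intro order_trans[OF mult_left_mono mult_right_mono]) (auto simp: w_def F_def)
      show "dsum (\<lambda>d. ln_nat d * Om d) n / (1 + r) \<le> 144 * w * F"
        using dsum_ln_Om_le[OF that] r0 by (simp add: divide_le_eq w_def F_def r_def mult_ac)
    qed
    also have "\<dots> = (12 * K * l3 + 144) * w * F" by (simp add: algebra_simps)
    also have "\<dots> \<le> ((12 * K + 144) * l3) * w * (exp (C + 1) * l1)"
      using K l3 w0 F F0 by (intro mult_mono) (auto simp: algebra_simps)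
    also have "\<dots> = M * l3 * l1 * davenport_w n"
      by (simp add: M_def davenport_w_eq_prime_sum[OF that] w_def mult_ac)
    finally show ?thesis by (simp add: l3_def l1_def)
  qed
  moreover have "0 < M" using K by (simp add: M_def)
  ultimately show ?thesis by blast
qed

end
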